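(* Consider the star $S=S(\alpha_1,\dots,\alpha_n)$ and an orbit $\mathcal{O}$ of rowmotion on $S$. Let $l=\operatorname{lcm}(\alpha_1,\dots,\alpha_n)$, and let $\delta=1$ if $\{\hat0\}\in\mathcal{O}$ and $\delta=0$ otherwise. (a) $\#\mathcal{O}=l+\delta$, and the number of orbits is $\alpha_1\cdots\alpha_n/l$. (b) For any $x\in S$, $$\chi_x(\mathcal{O})=\begin{cases} l/\alpha_i&\text{if }x\in B_i,\\ \delta&\text{if }x=\hat0.\end{cases}$$ (c) $$\chi(\mathcal{O})=\delta+\sum_{i=1}^n\frac{l}{\alpha_i}(\alpha_i-1).$$ Thus $\chi$ is homometric but not homomesic. (d) For any $x\in S$, $$\hat\chi_x(\mathcal{O})=\begin{cases} jl/\alpha_i&\text{if }x=x_{i,j},\\ l&\text{if }x=\hat0.\end{cases}$$ (e) $$\hat\chi(\mathcal{O})=l+\sum_{i=1}^n\frac{l}{\alpha_i}\binom{\alpha_i}{2}.$$ Thus $\hat\chi$ is homometric but not homomesic.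
   Context: For a finite poset $P$, let $\mathcal{A}(P)$ be its set of antichains, and for $Q\subseteq P$ let $Q{\downarrow}=\{x\in P: x\le y\text{ for some }y\in Q\}$. Rowmotion on antichains is the bijection $\rho(A)=\min\{x\in P: x\notin A{\downarrow}\}$ of $\mathcal{A}(P)$; rowmotion on lower order ideals is $\hat\rho(L)=\rho(\max L){\downarrow}$. The map $A\mapsto A{\downarrow}$ carries antichain orbits to ideal orbits. Orbits $\mathcal{O}$ are written as antichain orbits. For $x\in P$ and an antichain $A$, $\chi_x(A)=1$ if $x\in A$ and $0$ otherwise, and $\chi(A)=\#A$. For an ideal $L$, $\hat\chi_x(L)=1$ if $x\in L$ and $0$ otherwise, and $\hat\chi(L)=\#L$. The value of a statistic on an orbit is the sum of its values on the elements of the orbit; for an antichain orbit $\mathcal{O}$, $\hat\chi_x(\mathcal{O})$ and $\hat\chi(\mathcal{O})$ mean the sums of $\hat\chi_x(A{\downarrow})$ and $\hat\chi(A{\downarrow})$ over $A\in\mathcal{O}$. A statistic $\mathrm{st}$ is homomesic if $\mathrm{st}(\mathcal{O})/\#\mathcal{O}$ is the same constant for all orbits $\mathcal{O}$, and homometric if $\mathrm{st}(\mathcal{O}_1)=\mathrm{st}(\mathcal{O}_2)$ for any two orbits with $\#\mathcal{O}_1=\#\mathcal{O}_2$. For $n\ge2$ and integers $\alpha_1,\dots,\alpha_n\ge2$, the star $S(\alpha_1,\dots,\alpha_n)$ is the poset consisting of a unique minimal element $\hat0$ together with $n$ pairwise incomparable (disjoint) chains $B_1,\dots,B_n$ placed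 above $\hat0$, where $\#B_i=\alpha_i-1$. The elements of $B_i$ are denoted $x_{i,1},x_{i,2},\dots,x_{i,\alpha_i-1}$ starting with the maximal element $x_{i,1}$ and working down.
   Formalization: "Not homomesic" is claimed only when there are at least two orbits and, for χ, the star is not S(2,2): with a single orbit, as for S(2,3), every statistic is homomesic, and on S(2,2) χ has average 1 on both orbits. *)

theory Defs
  imports Complex_Main "HOL-Combinatorics.Orbits"
begin

text \<open>
  A poset is a subset \<open>P\<close> of a type of class \<open>order\<close>, with the induced order.
\<close>

definition min_elts :: "'a::order set \<Rightarrow> 'a set" where
  "min_elts X = {x \<in> X. \<forall>y\<in>X. \<not> y < x}"

definition max_elts :: "'a::order set \<Rightarrow> 'a set" where
  "max_elts X = {x \<in> X. \<forall>y\<in>X. \<not> x < y}"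

definition down :: "'a::order set \<Rightarrow> 'a set \<Rightarrow> 'a set" where
  "down P Q = {x \<in> P. \<exists>y\<in>Q. x \<le> y}"

definition antichains :: "'a::order set \<Rightarrow> 'a set set" where
  "antichains P = {A. A \<subseteq> P \<and> pairwise (\<lambda>x y. \<not> x \<le> y) A}"

definition ideals :: "'a::order set \<Rightarrow> 'a set set" where
  "ideals P = {L. L \<subseteq> P \<and> (\<forall>y\<in>L. \<forall>x\<in>P. x \<le> y \<longrightarrow> x \<in> L)}"

definition rowmotion :: "'a::order set \<Rightarrow> 'a set \<Rightarrow> 'a set" where
  "rowmotion P A = min_elts {x \<in> P. x \<notin> down P A}"

definition ideal_rowmotion :: "'a::order set \<Rightarrow> 'a set \<Rightarrow> 'a set" where
  "ideal_rowmotion P L = down P (rowmotion P (max_elts L))"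

text \<open>
  \<^const>\<open>orbit\<close> collects the iterates with exponent at least 1; for a bijection
  of a finite set \<open>X\<close> this is the usual orbit.
\<close>

definition orbits_on :: "('b \<Rightarrow> 'b) \<Rightarrow> 'b set \<Rightarrow> 'b set set" where
  "orbits_on f X = orbit f ` X"

definition homomesic :: "('b \<Rightarrow> 'b) \<Rightarrow> 'b set \<Rightarrow> ('b \<Rightarrow> real) \<Rightarrow> bool" where
  "homomesic f X st \<longleftrightarrow>
     (\<exists>c. \<forall>\<O>\<in>orbits_on f X. sum st \<O> / real (card \<O>) = c)"

definition homometric :: "('b \<Rightarrow> 'b) \<Rightarrow> 'b set \<Rightarrow> ('b \<Rightarrow> real) \<Rightarrow> bool" where
  "homometric f X st \<longleftrightarrow>
     (\<forall>\<O>\<^sub>1\<in>orbits_on f X. \<forall>\<O>\<^sub>2\<in>orbits_on f X.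
        card \<O>\<^sub>1 = card \<O>\<^sub>2 \<longrightarrow> sum st \<O>\<^sub>1 = sum st \<O>\<^sub>2)"

text \<open>
  The same two functions serve as the antichain statistics and, applied to lower order
  ideals, as their hatted versions.
\<close>

definition chi_at :: "'a \<Rightarrow> 'a set \<Rightarrow> real" where
  "chi_at x A = (if x \<in> A then 1 else 0)"

definition chi :: "'a set \<Rightarrow> real" where
  "chi A = real (card A)"

text \<open>
  \<open>Root\<close> is the minimum of the star and \<open>Elt i j\<close> is the element \<open>x\<^sub>i\<^sub>,\<^sub>j\<close>. The second index
  counts downwards from the top of the chain, so a larger \<open>j\<close> means a smaller element.
\<close>

datatype star_elt = Root | Elt nat nat

instantiation star_elt :: order
begin

fun less_eq_star_elt :: "star_elt \<Rightarrow> star_elt \<Rightarrow> bool" where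
  "Root \<le> y \<longleftrightarrow> True"
| "Elt i j \<le> Root \<longleftrightarrow> False"
| "Elt i j \<le> Elt i' j' \<longleftrightarrow> i = i' \<and> j' \<le> j"

definition less_star_elt :: "star_elt \<Rightarrow> star_elt \<Rightarrow> bool" where
  "less_star_elt x y \<longleftrightarrow> x \<le> y \<and> \<not> y \<le> x"

instance
proof
  fix x y z :: star_elt
  show "x < y \<longleftrightarrow> x \<le> y \<and> \<not> y \<le> x" by (simp add: less_star_elt_def)
  show "x \<le> x" by (cases x) auto
  show "x \<le> z" if "x \<le> y" "y \<le> z" using that by (cases x; cases y; cases z) auto
  show "x = y" if "x \<le> y" "y \<le> x" using that by (cases x; cases y) auto
qed

end

definition branch :: "(nat \<Rightarrow> nat) \<Rightarrow> nat \<Rightarrow> star_elt set" where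
  "branch \<alpha> i = {Elt i j | j. j \<in> {1..\<alpha> i - 1}}"

definition star :: "nat \<Rightarrow> (nat \<Rightarrow> nat) \<Rightarrow> star_elt set" where
  "star n \<alpha> = {Root} \<union> (\<Union>i\<in>{1..n}. branch \<alpha> i)"

end

theory Submission
  imports Defs
begin

text \<open>
  Rowmotion on a star is an odometer with one extra stop. An antichain other than the singleton
  of the root meets each chain \<open>B\<^sub>i\<close> at most once, so it is coded by one residue modulo
  \<open>\<alpha>\<^sub>i\<close> per chain: the index \<open>j\<close> of the element \<open>x\<^sub>i\<^sub>,\<^sub>j\<close> that it contains, or \<open>0\<close> if it
  misses the chain. As long as the antichain is nonempty, rowmotion subtracts \<open>1\<close> from every
  residue at once (\<open>rowmotion_config\<close>): it moves one step up in a chain, and a chain that has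
  been left is entered again at its bottom. Only the empty antichain, whose residues all vanish,
  behaves differently: it goes to the singleton of the root, which then goes to the code with
  all residues \<open>-1\<close>. Rowmotion therefore inserts one additional state right after the all-zero
  code.

  Simultaneous subtraction of \<open>1\<close> has all its cycles of length \<open>l = lcm(\<alpha>\<^sub>1, \<dots>, \<alpha>\<^sub>n)\<close>. Hence
  an orbit has \<open>l\<close> elements, and one more if it passes through the root. The number of orbits
  follows by counting all antichains, since exactly one orbit contains the root
  (\<open>card_orbs\<close>).

  Along a cycle the \<open>i\<close>-th residue runs through all residues modulo \<open>\<alpha>\<^sub>i\<close> exactly
  \<open>l / \<alpha>\<^sub>i\<close> times (\<open>equidistribution\<close>). Membership of \<open>x\<^sub>i\<^sub>,\<^sub>j\<close> in an antichain says that the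
  residue is \<open>j\<close>, membership in the generated ideal that it lies between \<open>1\<close> and \<open>j\<close>; this
  gives \<open>l / \<alpha>\<^sub>i\<close> and \<open>j l / \<alpha>\<^sub>i\<close>. Cardinalities are sums of these indicators.

  Both cardinality statistics have orbit sums of the form \<open>K + a \<delta>\<close> with constants \<open>K\<close> and \<open>a\<close>,
  while the orbit has \<open>l + \<delta>\<close> elements. Equal size forces equal \<open>\<delta>\<close>, which is homometry. If
  there are two orbits, both values of \<open>\<delta>\<close> occur, and the averages \<open>K / l\<close> and
  \<open>(K + a) / (l + 1)\<close> agree only if \<open>K = a l\<close>. For antichains \<open>a = 1\<close>, and \<open>K = l\<close> means
  that the numbers \<open>1 - 1/\<alpha>\<^sub>i\<close>, each at least \<open>1/2\<close>, add up to \<open>1\<close>, so \<open>n = 2\<close> and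
  \<open>\<alpha>\<^sub>1 = \<alpha>\<^sub>2 = 2\<close>. For ideals \<open>a = 0\<close> and \<open>K > 0\<close>.
\<close>

section \<open>Antichains and ideals of a finite poset\<close>

lemma max_elts_down:
  assumes "A \<in> antichains P"
  shows "max_elts (down P A) = A"
proof
  have anti: "x = y" if "x \<in> A" "y \<in> A" "x \<le> y" for x y
    using assms that unfolding antichains_def pairwise_def by auto
  have sub: "A \<subseteq> P" using assms unfolding antichains_def by auto
  then have A: "A \<subseteq> down P A" unfolding down_def by auto
  show "max_elts (down P A) \<subseteq> A"
  proof
    fix x assume x: "x \<in> max_elts (down P A)"
    then obtain y where y: "y \<in> A" "x \<le> y" unfolding max_elts_def down_def by auto
    with A x have "\<not> x < y" unfolding max_elts_def by auto
    with y show "x \<in> A" by auto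
  qed
  show "A \<subseteq> max_elts (down P A)"
  proof
    fix x assume x: "x \<in> A"
    have "\<not> x < y" if y: "y \<in> down P A" for y
    proof
      assume "x < y"
      obtain z where z: "z \<in> A" "y \<le> z" using y unfolding down_def by auto
      with \<open>x < y\<close> have "x < z" using less_le_trans by blast
      with anti[OF x z(1)] show False by (simp add: order.strict_implies_order)
    qed
    then show "x \<in> max_elts (down P A)" using x A unfolding max_elts_def by auto
  qed
qed

text \<open>
  Finiteness is what puts every element of an ideal below a maximal one.
\<close>

lemma down_max_elts:
  assumes "finite P" "L \<in> ideals P"
  shows "down P (max_elts L) = L"
proof
  have L: "L \<subseteq> P" "\<And>x y. y \<in> L \<Longrightarrow> x \<in> P \<Longrightarrow> x \<le> y \<Longrightarrow> x \<in> L"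
    using assms(2) unfolding ideals_def by auto
  then show "down P (max_elts L) \<subseteq> L" unfolding down_def max_elts_def by blast
  have "finite L" using assms(1) L(1) finite_subset by blast
  show "L \<subseteq> down P (max_elts L)"
  proof
    fix x assume x: "x \<in> L"
    obtain m where "m \<in> L" "x \<le> m" "\<forall>b\<in>L. m \<le> b \<longrightarrow> m = b"
      using finite_has_maximal2[OF \<open>finite L\<close> x] by blast
    then have "m \<in> max_elts L" unfolding max_elts_def by auto
    with \<open>x \<le> m\<close> x L(1) show "x \<in> down P (max_elts L)" unfolding down_def by auto
  qed
qed

lemma rowmotion_antichain: "rowmotion P A \<in> antichains P"
  unfolding rowmotion_def min_elts_def antichains_def pairwise_def
  by (auto simp: order.order_iff_strict)

lemma down_ideal: "down P A \<in> ideals P"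
  unfolding down_def ideals_def by (auto intro: order_trans)

lemma max_elts_antichain: "L \<in> ideals P \<Longrightarrow> max_elts L \<in> antichains P"
  unfolding max_elts_def ideals_def antichains_def pairwise_def
  by (auto simp: order.order_iff_strict)

lemma ideals_eq_down_image:
  assumes "finite P"
  shows "ideals P = down P ` antichains P"
  using down_max_elts[OF assms] max_elts_antichain down_ideal by (auto intro!: rev_image_eqI)

lemma inj_on_down: "inj_on (down P) (antichains P)"
  by (rule inj_on_inverseI) (rule max_elts_down)

lemma orbit_rowmotion_antichains: "orbit (rowmotion P) A \<subseteq> antichains P"
proof
  fix B assume "B \<in> orbit (rowmotion P) A"
  then show "B \<in> antichains P" by cases (simp_all add: rowmotion_antichain)
qed

lemma orbit_ideal_rowmotion:
  assumes "A \<in> antichains P"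
  shows "orbit (ideal_rowmotion P) (down P A) = down P ` orbit (rowmotion P) A"
proof -
  have conj: "ideal_rowmotion P (down P B) = down P (rowmotion P B)" if "B \<in> antichains P" for B
    using max_elts_down[OF that] by (simp add: ideal_rowmotion_def)
  have "(ideal_rowmotion P ^^ m) (down P A) = down P ((rowmotion P ^^ m) A)
        \<and> (rowmotion P ^^ m) A \<in> antichains P" for m
    by (induction m) (auto simp: assms conj rowmotion_antichain)
  then show ?thesis by (auto simp: orbit_altdef)
qed

text \<open>
  Passing to ideals is a conjugation of dynamical systems, so statistics on ideal orbits can
  be read off from the antichain orbits.
\<close>

lemma orbits_ideal_rowmotion:
  assumes "finite P"
  shows "orbits_on (ideal_rowmotion P) (ideals P)
       = (\<lambda>\<O>. down P ` \<O>) ` orbits_on (rowmotion P) (antichains P)"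
  unfolding orbits_on_def ideals_eq_down_image[OF assms] image_image
  by (rule image_cong) (simp_all add: orbit_ideal_rowmotion)

lemma orbit_subset_antichains:
  "\<O> \<in> orbits_on (rowmotion P) (antichains P) \<Longrightarrow> \<O> \<subseteq> antichains P"
  using orbit_rowmotion_antichains unfolding orbits_on_def by blast

lemma image_down_orbit:
  assumes "\<O> \<in> orbits_on (rowmotion P) (antichains P)"
  shows "card (down P ` \<O>) = card \<O>" "sum st (down P ` \<O>) = (\<Sum>A\<in>\<O>. st (down P A))"
proof -
  have inj: "inj_on (down P) \<O>"
    by (rule inj_on_subset[OF inj_on_down orbit_subset_antichains[OF assms]])
  show "card (down P ` \<O>) = card \<O>" by (rule card_image[OF inj])
  show "sum st (down P ` \<O>) = (\<Sum>A\<in>\<O>. st (down P A))"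
    unfolding sum.reindex[OF inj] by (simp only: o_def)
qed

lemma ideal_homometric_iff:
  assumes "finite P"
  shows "homometric (ideal_rowmotion P) (ideals P) st
     \<longleftrightarrow> homometric (rowmotion P) (antichains P) (\<lambda>A. st (down P A))"
  unfolding homometric_def orbits_ideal_rowmotion[OF assms]
  by (simp add: image_down_orbit cong: ball_cong)

lemma ideal_homomesic_iff:
  assumes "finite P"
  shows "homomesic (ideal_rowmotion P) (ideals P) st
     \<longleftrightarrow> homomesic (rowmotion P) (antichains P) (\<lambda>A. st (down P A))"
  unfolding homomesic_def orbits_ideal_rowmotion[OF assms]
  by (simp add: image_down_orbit cong: ball_cong)


section \<open>Closed walks and residues\<close>

text \<open>
  If \<open>f\<close> pushes a point around a closed walk, the walk is the forward orbit of each of its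
  points. This yields orbits without showing first that \<open>f\<close> is a bijection.
\<close>

lemma orbit_of_closed_walk:
  fixes g :: "nat \<Rightarrow> 'a"
  assumes step: "\<And>t. t < p \<Longrightarrow> f (g t) = g (Suc t mod p)" and x: "x \<in> g ` {..<p}"
  shows "orbit f x = g ` {..<p}"
proof -
  obtain s where s: "s < p" "x = g s" using x by blast
  have iter: "(f ^^ m) x = g ((s + m) mod p)" for m
  proof (induction m)
    case (Suc m)
    have "(f ^^ Suc m) x = g (Suc ((s + m) mod p) mod p)"
      using Suc step[of "(s + m) mod p"] s(1) by simp
    then show ?case by (simp only: mod_Suc_eq add_Suc_right)
  qed (use s in simp)
  have "\<exists>m>0. g t = (f ^^ m) x" if "t < p" for t
  proof -
    have "s + (t + p - s) = t + p" using s by simp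
    then have "(s + (t + p - s)) mod p = t" using that by simp
    moreover have "t + p - s > 0" using s by simp
    ultimately show ?thesis using iter by metis
  qed
  then show ?thesis using s iter by (auto simp: orbit_altdef)
qed

text \<open>
  Among \<open>k\<close> consecutive blocks of \<open>a\<close> consecutive integers each residue modulo \<open>a\<close> occurs
  \<open>k\<close> times.
\<close>

lemma sum_over_residues:
  fixes f :: "int \<Rightarrow> real" and c :: int and a k :: nat
  shows "(\<Sum>t<k * a. f ((c - int t) mod int a)) = real k * (\<Sum>r<a. f (int r))"
proof (cases "a = 0")
  case False
  have block: "(\<Sum>t=m*a..<m*a+a. f ((c - int t) mod int a)) = (\<Sum>r<a. f (int r))" for m
  proof -
    \<comment> \<open>Two times in a block differ by less than the period, so equal residues force equal times.\<close>
    have inj: "inj_on (\<lambda>t. nat ((c - int t) mod int a)) {m*a..<m*a+a}"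
    proof (rule inj_onI)
      fix t u assume tu: "t \<in> {m*a..<m*a+a}" "u \<in> {m*a..<m*a+a}"
        and "nat ((c - int t) mod int a) = nat ((c - int u) mod int a)"
      then have "(c - int t) mod int a = (c - int u) mod int a"
        using False eq_nat_nat_iff[of "(c - int t) mod int a" "(c - int u) mod int a"] by simp
      then have "int a dvd (c - int t) - (c - int u)" by (rule mod_eq_dvd_iff[THEN iffD1])
      then have "int a dvd int u - int t" by simp
      moreover have "\<bar>int u - int t\<bar> < int a" using tu by auto
      ultimately have "int u - int t = 0"
        using dvd_imp_le_int[of "int u - int t" "int a"] by linarith
      then show "t = u" by simp
    qed
    moreover have "(\<lambda>t. nat ((c - int t) mod int a)) ` {m*a..<m*a+a} = {..<a}"
    proof (rule card_subset_eq)
      show "(\<lambda>t. nat ((c - int t) mod int a)) ` {m*a..<m*a+a} \<subseteq> {..<a}"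
        using False by (auto simp: nat_less_iff)
      show "card ((\<lambda>t. nat ((c - int t) mod int a)) ` {m*a..<m*a+a}) = card {..<a}"
        using card_image[OF inj] by simp
    qed simp
    ultimately have "bij_betw (\<lambda>t. nat ((c - int t) mod int a)) {m*a..<m*a+a} {..<a}"
      unfolding bij_betw_def by blast
    from sum.reindex_bij_betw[OF this, of "\<lambda>r. f (int r)"]
    show ?thesis using False by simp
  qed
  have "(\<Sum>t<k * a. f ((c - int t) mod int a))
      = (\<Sum>m<k. \<Sum>t=m*a..<m*a+a. f ((c - int t) mod int a))"
    by (rule sum.nat_group[symmetric])
  also have "\<dots> = real k * (\<Sum>r<a. f (int r))" by (simp add: block)
  finally show ?thesis .
qed simp


section \<open>Rowmotion on a star as an odometer\<close>

locale star_shape =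
  fixes n :: nat and \<alpha> :: "nat \<Rightarrow> nat"
  assumes n_ge: "n \<ge> 2" and \<alpha>_ge: "\<And>i. i \<in> {1..n} \<Longrightarrow> \<alpha> i \<ge> 2"
begin

abbreviation "S \<equiv> star n \<alpha>"
abbreviation "\<rho> \<equiv> rowmotion S"
abbreviation "orbs \<equiv> orbits_on \<rho> (antichains S)"

definition l :: nat where "l = Lcm (\<alpha> ` {1..n})"

text \<open>
  The code of an antichain takes arbitrary integers and reduces them only when the set is
  formed, so that rowmotion is plain subtraction of \<open>1\<close>, without wrap-around.
\<close>

definition config :: "(nat \<Rightarrow> int) \<Rightarrow> star_elt set" where
  "config c = {Elt i (nat (c i mod int (\<alpha> i))) | i. i \<in> {1..n} \<and> c i mod int (\<alpha> i) \<noteq> 0}"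

text \<open>
  A cycle of the odometer, that is, of simultaneous subtraction of \<open>1\<close> without the stop at the
  root. Time ranges over all integers, which makes the cycle visibly independent of its starting
  point.
\<close>

definition track :: "(nat \<Rightarrow> int) \<Rightarrow> star_elt set set" where
  "track c = range (\<lambda>t::int. config (\<lambda>i. c i - t))"

lemma residue_bounds:
  "i \<in> {1..n} \<Longrightarrow> 0 \<le> x mod int (\<alpha> i)" "i \<in> {1..n} \<Longrightarrow> x mod int (\<alpha> i) < int (\<alpha> i)"
  using \<alpha>_ge[of i] by simp_all

lemma Elt_in_config:
  "Elt i j \<in> config c \<longleftrightarrow> i \<in> {1..n} \<and> j \<ge> 1 \<and> int j = c i mod int (\<alpha> i)"
  using residue_bounds(1)[of i "c i"] by (auto simp: config_def)

lemma Root_notin_config: "Root \<notin> config c"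
  by (auto simp: config_def)

lemma Root_in_star: "Root \<in> S"
  by (auto simp: star_def)

lemma Elt_in_star: "Elt i j \<in> S \<longleftrightarrow> i \<in> {1..n} \<and> 1 \<le> j \<and> j < \<alpha> i"
  by (auto simp: star_def branch_def)

lemma finite_branch: "finite (branch \<alpha> i)"
  unfolding branch_def by simp

lemma finite_star: "finite S"
  unfolding star_def by (simp add: finite_branch)

lemma finite_antichains: "finite (antichains S)"
  by (rule finite_subset[of _ "Pow S"]) (auto simp: antichains_def finite_star)

lemma sum_star: "(\<Sum>x\<in>S. f x) = f Root + (\<Sum>i=1..n. \<Sum>j=1..\<alpha> i - 1. f (Elt i j))"
  for f :: "star_elt \<Rightarrow> real"
proof -
  have "(\<Sum>x\<in>S. f x) = f Root + (\<Sum>x\<in>(\<Union>i\<in>{1..n}. branch \<alpha> i). f x)"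
    unfolding star_def by (simp, subst sum.insert) (auto simp: branch_def)
  also have "(\<Sum>x\<in>(\<Union>i\<in>{1..n}. branch \<alpha> i). f x) = (\<Sum>i=1..n. \<Sum>x\<in>branch \<alpha> i. f x)"
    by (rule sum.UNION_disjoint) (auto simp: finite_branch, auto simp: branch_def)
  also have "\<dots> = (\<Sum>i=1..n. \<Sum>j=1..\<alpha> i - 1. f (Elt i j))"
  proof (rule sum.cong[OF refl])
    fix i
    have "branch \<alpha> i = Elt i ` {1..\<alpha> i - 1}" by (auto simp: branch_def)
    then show "(\<Sum>x\<in>branch \<alpha> i. f x) = (\<Sum>j=1..\<alpha> i - 1. f (Elt i j))"
      by (simp add: sum.reindex inj_on_def)
  qed
  finally show ?thesis .
qed

lemma config_subset_star: "config c \<subseteq> S"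
proof
  fix x assume x: "x \<in> config c"
  then obtain i j where [simp]: "x = Elt i j" using Root_notin_config by (cases x) auto
  show "x \<in> S" using x residue_bounds(2)[of i "c i"] by (simp add: Elt_in_config Elt_in_star)
qed

lemma config_antichain: "config c \<in> antichains S"
proof -
  have "\<not> x \<le> y" if "x \<in> config c" "y \<in> config c" "x \<noteq> y" for x y
    using that Root_notin_config[of c] by (cases x; cases y) (auto simp: Elt_in_config)
  then show ?thesis using config_subset_star unfolding antichains_def pairwise_def by blast
qed

lemma Root_antichain: "{Root} \<in> antichains S"
  using Root_in_star by (auto simp: antichains_def)

lemma config_cong_iff:
  "config c = config d \<longleftrightarrow> (\<forall>i\<in>{1..n}. c i mod int (\<alpha> i) = d i mod int (\<alpha> i))"
proof
  assume eq: "config c = config d"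
  show "\<forall>i\<in>{1..n}. c i mod int (\<alpha> i) = d i mod int (\<alpha> i)"
  proof
    fix i assume i: "i \<in> {1..n}"
    have "int j = c i mod int (\<alpha> i) \<longleftrightarrow> int j = d i mod int (\<alpha> i)" if "j \<ge> 1" for j
      using Elt_in_config[of i j c] Elt_in_config[of i j d] eq i that by simp
    from this[of "nat (c i mod int (\<alpha> i))"] this[of "nat (d i mod int (\<alpha> i))"]
    show "c i mod int (\<alpha> i) = d i mod int (\<alpha> i)"
      using residue_bounds(1)[OF i, of "c i"] residue_bounds(1)[OF i, of "d i"] by linarith
  qed
qed (auto simp: config_def)

lemma config_empty_iff: "config c = {} \<longleftrightarrow> (\<forall>i\<in>{1..n}. c i mod int (\<alpha> i) = 0)"
  by (auto simp: config_def)

text \<open>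
  The root is comparable to everything, so it occurs only alone; an antichain without it
  meets each chain at most once, and the index of the meeting point is its residue there.
\<close>

lemma antichains_star: "antichains S = insert {Root} (range config)"
proof
  show "insert {Root} (range config) \<subseteq> antichains S"
    using Root_antichain config_antichain by auto
  show "antichains S \<subseteq> insert {Root} (range config)"
  proof
    fix A assume "A \<in> antichains S"
    then have sub: "A \<subseteq> S" and anti: "\<And>x y. x \<in> A \<Longrightarrow> y \<in> A \<Longrightarrow> x \<le> y \<Longrightarrow> x = y"
      unfolding antichains_def pairwise_def by auto
    show "A \<in> insert {Root} (range config)"
    proof (cases "Root \<in> A")
      case True
      then have "A = {Root}" using anti[of Root] by auto
      then show ?thesis by simp
    next
      case False
      have uniq: "j = k" if "Elt i j \<in> A" "Elt i k \<in> A" for i j k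
        using anti[of "Elt i j" "Elt i k"] anti[of "Elt i k" "Elt i j"] that by fastforce
      define c where "c i = (if \<exists>j. Elt i j \<in> A then int (THE j. Elt i j \<in> A) else 0)" for i
      have c: "c i = int j" if "Elt i j \<in> A" for i j
      proof -
        have "(THE j. Elt i j \<in> A) = j" using that uniq by blast
        then show ?thesis using that unfolding c_def by auto
      qed
      have c': "c i = 0 \<or> (\<exists>j. Elt i j \<in> A \<and> c i = int j)" for i
        using c c_def by metis
      have "Elt i j \<in> A \<longleftrightarrow> Elt i j \<in> config c" for i j
      proof
        assume A: "Elt i j \<in> A"
        with sub have "Elt i j \<in> S" by auto
        with c[OF A] show "Elt i j \<in> config c" by (simp add: Elt_in_config Elt_in_star)
      next
        assume a: "Elt i j \<in> config c"
        then have j: "j \<ge> 1" "int j = c i mod int (\<alpha> i)" by (auto simp: Elt_in_config)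
        then obtain k where k: "Elt i k \<in> A" "c i = int k" using c'[of i] by fastforce
        with sub have "k < \<alpha> i" by (auto simp: Elt_in_star)
        with j k show "Elt i j \<in> A" by simp
      qed
      then have "A = config c"
        using False Root_notin_config by (metis star_elt.exhaust set_eqI)
      then show ?thesis by simp
    qed
  qed
qed

lemma card_antichains: "card (antichains S) = Suc (\<Prod>i=1..n. \<alpha> i)"
proof -
  let ?B = "Pi\<^sub>E {1..n} (\<lambda>i. {0..<int (\<alpha> i)})"
  have "range config = config ` ?B"
  proof
    show "range config \<subseteq> config ` ?B"
    proof
      fix A assume "A \<in> range config"
      then obtain c where A: "A = config c" by auto
      have "A = config (restrict (\<lambda>i. c i mod int (\<alpha> i)) {1..n})"
        unfolding A config_cong_iff by simp
      moreover have "restrict (\<lambda>i. c i mod int (\<alpha> i)) {1..n} \<in> ?B"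
        using residue_bounds by auto
      ultimately show "A \<in> config ` ?B" by blast
    qed
  qed auto
  moreover have "inj_on config ?B"
  proof (rule inj_onI)
    fix c d assume cd: "c \<in> ?B" "d \<in> ?B" "config c = config d"
    show "c = d"
    proof (rule PiE_ext[OF cd(1,2)])
      fix i assume i: "i \<in> {1..n}"
      have "c i \<in> {0..<int (\<alpha> i)}" "d i \<in> {0..<int (\<alpha> i)}"
        using cd(1,2) i by (blast dest: PiE_mem)+
      moreover have "c i mod int (\<alpha> i) = d i mod int (\<alpha> i)" using cd(3) i config_cong_iff by blast
      ultimately show "c i = d i" by simp
    qed
  qed
  ultimately have "card (range config) = (\<Prod>i=1..n. \<alpha> i)"
    by (simp add: card_image card_PiE)
  moreover have "finite (range config)"
    using finite_antichains antichains_star by simp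
  moreover have "{Root} \<notin> range config" using Root_notin_config by auto
  ultimately show ?thesis unfolding antichains_star by simp
qed

lemma Elt_in_down_config:
  "Elt i j \<in> down S (config c) \<longleftrightarrow>
     Elt i j \<in> S \<and> 1 \<le> c i mod int (\<alpha> i) \<and> c i mod int (\<alpha> i) \<le> int j"
proof
  assume "Elt i j \<in> down S (config c)"
  then obtain y where y: "Elt i j \<in> S" "y \<in> config c" "Elt i j \<le> y" by (auto simp: down_def)
  then show "Elt i j \<in> S \<and> 1 \<le> c i mod int (\<alpha> i) \<and> c i mod int (\<alpha> i) \<le> int j"
    by (cases y) (auto simp: Elt_in_config)
next
  assume a: "Elt i j \<in> S \<and> 1 \<le> c i mod int (\<alpha> i) \<and> c i mod int (\<alpha> i) \<le> int j"
  then have "Elt i (nat (c i mod int (\<alpha> i))) \<in> config c" 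
    by (auto simp: Elt_in_config Elt_in_star le_nat_iff)
  moreover have "Elt i j \<le> Elt i (nat (c i mod int (\<alpha> i)))" using a by (simp add: nat_le_iff)
  ultimately show "Elt i j \<in> down S (config c)" using a unfolding down_def by blast
qed

lemma Root_in_down: "Root \<in> down S A \<longleftrightarrow> A \<noteq> {}"
  using Root_in_star by (auto simp: down_def)

lemma down_Root: "down S {Root} = {Root}"
proof -
  have "x \<le> Root \<longleftrightarrow> x = Root" for x :: star_elt by (cases x) auto
  then show ?thesis using Root_in_star by (auto simp: down_def)
qed

text \<open>
  The elements outside a down-set fill an upper segment of each chain. So minimality only has to
  be tested along the element's own chain, provided that the root, which lies below all chains,
  is covered; this is the condition \<open>A \<noteq> {}\<close>.
\<close>

lemma Elt_in_rowmotion: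
  "Elt i j \<in> \<rho> A \<longleftrightarrow> A \<noteq> {} \<and> Elt i j \<in> S \<and> Elt i j \<notin> down S A
     \<and> (\<forall>k. j < k \<and> k < \<alpha> i \<longrightarrow> Elt i k \<in> down S A)" (is "?L = ?R")
proof
  assume L: ?L
  then have 1: "Elt i j \<in> S" "Elt i j \<notin> down S A"
    and min: "\<And>y. y \<in> S \<Longrightarrow> y \<notin> down S A \<Longrightarrow> \<not> y < Elt i j"
    unfolding rowmotion_def min_elts_def by auto
  have "A \<noteq> {}" using min[OF Root_in_star] Root_in_down by (auto simp: less_star_elt_def)
  moreover have "Elt i k \<in> down S A" if "j < k \<and> k < \<alpha> i" for k
    using min[of "Elt i k"] that 1 by (auto simp: less_star_elt_def Elt_in_star)
  ultimately show ?R using 1 by blast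
next
  assume R: ?R
  have "\<not> y < Elt i j" if "y \<in> S" "y \<notin> down S A" for y
    using that R Root_in_down by (cases y) (auto simp: less_star_elt_def Elt_in_star)
  then show ?L using R unfolding rowmotion_def min_elts_def by blast
qed

lemma Root_in_rowmotion: "Root \<in> \<rho> A \<longleftrightarrow> A = {}"
proof -
  have "\<not> y < Root" for y :: star_elt by (auto simp: less_star_elt_def)
  then show ?thesis
    using Root_in_star Root_in_down by (auto simp: rowmotion_def min_elts_def)
qed

text \<open>
  The odometer step. With residue \<open>r \<noteq> 0\<close> the down-set covers the indices \<open>j \<ge> r\<close>, so the
  lowest uncovered element has index \<open>r - 1\<close>, and none is left if \<open>r = 1\<close>. With \<open>r = 0\<close> the
  whole chain is uncovered and its bottom element, of index \<open>\<alpha> i - 1\<close>, is taken.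
\<close>

lemma rowmotion_config:
  assumes "config c \<noteq> {}"
  shows "\<rho> (config c) = config (\<lambda>i. c i - 1)"
proof -
  have "Elt i j \<in> \<rho> (config c) \<longleftrightarrow> Elt i j \<in> config (\<lambda>i. c i - 1)" for i j
  proof (cases "i \<in> {1..n}")
    case True
    let ?a = "int (\<alpha> i)" and ?r = "c i mod int (\<alpha> i)"
    have r: "0 \<le> ?r" "?r < ?a" and a: "?a \<ge> 2"
      using residue_bounds[OF True] \<alpha>_ge[OF True] by auto
    have pred: "(c i - 1) mod ?a = (if ?r = 0 then ?a - 1 else ?r - 1)"
    proof -
      have "(c i - 1) mod ?a = (?r - 1) mod ?a" by (simp add: mod_diff_left_eq)
      moreover have "(- 1) mod ?a = ?a - 1"
        using a by (simp add: zmod_minus1)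
      moreover have "(?r - 1) mod ?a = ?r - 1" if "?r \<noteq> 0"
        using r that by (intro mod_pos_pos_trivial) linarith+
      ultimately show ?thesis by auto
    qed
    have "Elt i j \<in> \<rho> (config c) \<longleftrightarrow> 1 \<le> j \<and> j < \<alpha> i \<and> \<not> (1 \<le> ?r \<and> ?r \<le> int j)
       \<and> (\<forall>k. j < k \<and> k < \<alpha> i \<longrightarrow> 1 \<le> ?r \<and> ?r \<le> int k)"
      using True assms by (auto simp: Elt_in_rowmotion Elt_in_down_config Elt_in_star)
    also have "\<dots> \<longleftrightarrow> 1 \<le> j \<and> int j = (c i - 1) mod ?a"
    proof (cases "?r = 0")
      case z: True
      have "(\<forall>k. j < k \<and> k < \<alpha> i \<longrightarrow> False) \<longleftrightarrow> \<alpha> i \<le> Suc j"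
        by (metis Suc_leI lessI not_le order_le_less_trans order_less_le_trans)
      then show ?thesis unfolding pred using z by auto
    next
      case nz: False
      have "(1 \<le> j \<and> j < \<alpha> i \<and> \<not> ?r \<le> int j \<and> (\<forall>k. j < k \<and> k < \<alpha> i \<longrightarrow> ?r \<le> int k))
          \<longleftrightarrow> 1 \<le> j \<and> int j = ?r - 1" (is "?L = ?R")
      proof
        assume L: ?L
        then have "?r \<le> int (Suc j)" using r by (cases "Suc j < \<alpha> i") auto
        with L show ?R by auto
      qed (use r in auto)
      then show ?thesis unfolding pred using nz r by auto
    qed
    finally show ?thesis using True by (simp add: Elt_in_config)
  qed (auto simp: Elt_in_rowmotion Elt_in_config Elt_in_star)
  moreover have "Root \<in> \<rho> (config c) \<longleftrightarrow> Root \<in> config (\<lambda>i. c i - 1)"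
    using assms by (simp add: Root_in_rowmotion Root_notin_config)
  ultimately show ?thesis by (metis set_eqI star_elt.exhaust)
qed

lemma rowmotion_empty: "\<rho> {} = {Root}"
proof -
  have "x \<in> \<rho> {} \<longleftrightarrow> x = Root" for x
    by (cases x) (simp_all add: Root_in_rowmotion Elt_in_rowmotion)
  then show ?thesis by auto
qed

lemma rowmotion_Root: "\<rho> {Root} = config (\<lambda>_. - 1)"
proof -
  have "x \<in> \<rho> {Root} \<longleftrightarrow> x \<in> config (\<lambda>_. - 1)" for x
  proof (cases x)
    case Root
    then show ?thesis by (simp add: Root_in_rowmotion Root_notin_config)
  next
    case (Elt i j)
    have "(\<forall>k. \<not> (j < k \<and> k < \<alpha> i)) \<longleftrightarrow> \<alpha> i \<le> Suc j"
      by (metis Suc_leI lessI not_le order_le_less_trans order_less_le_trans)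
    moreover have "(- 1) mod int (\<alpha> i) = int (\<alpha> i) - 1" if "i \<in> {1..n}"
      using \<alpha>_ge[OF that] by (simp add: zmod_minus1)
    ultimately show ?thesis using Elt \<alpha>_ge
      by (auto simp: Elt_in_rowmotion Elt_in_config down_Root Elt_in_star)
  qed
  then show ?thesis by auto
qed


section \<open>The orbits\<close>

lemma l_pos: "l > 0"
proof -
  have "0 \<notin> \<alpha> ` {1..n}" using \<alpha>_ge by fastforce
  then have "Lcm (\<alpha> ` {1..n}) \<noteq> 0" by (subst Lcm_0_iff) simp_all
  then show ?thesis unfolding l_def by (rule neq0_conv[THEN iffD1])
qed

lemma \<alpha>_dvd_l: "i \<in> {1..n} \<Longrightarrow> \<alpha> i dvd l"
  unfolding l_def by (rule dvd_Lcm) simp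

lemma l_dvd_iff: "int l dvd x \<longleftrightarrow> (\<forall>i\<in>{1..n}. int (\<alpha> i) dvd x)"
proof -
  have "l dvd nat \<bar>x\<bar> \<longleftrightarrow> (\<forall>i\<in>{1..n}. \<alpha> i dvd nat \<bar>x\<bar>)"
    unfolding l_def by (simp only: Lcm_dvd_iff ball_simps)
  then show ?thesis by (simp only: dvd_nat_abs_iff)
qed

text \<open>
  All residues agree exactly when the time difference is a multiple of every \<open>\<alpha> i\<close>, hence of
  their least common multiple: the period of every cycle is \<open>l\<close>.
\<close>

lemma config_shift_eq_iff:
  "config (\<lambda>i. c i - t) = config (\<lambda>i. c i - u) \<longleftrightarrow> t mod int l = u mod int l"
proof -
  have "(x - t) mod a = (x - u) mod a \<longleftrightarrow> a dvd t - u" for x a :: int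
    by (simp add: mod_eq_dvd_iff dvd_diff_commute)
  then show ?thesis by (simp add: config_cong_iff mod_eq_dvd_iff l_dvd_iff)
qed

lemma track_eq: "track c = (\<lambda>t. config (\<lambda>i. c i - int t)) ` {..<l}"
proof
  show "track c \<subseteq> (\<lambda>t. config (\<lambda>i. c i - int t)) ` {..<l}"
  proof
    fix A assume "A \<in> track c"
    then obtain t where "A = config (\<lambda>i. c i - t)" unfolding track_def by auto
    also have "\<dots> = config (\<lambda>i. c i - int (nat (t mod int l)))"
      unfolding config_shift_eq_iff using l_pos by simp
    finally show "A \<in> (\<lambda>t. config (\<lambda>i. c i - int t)) ` {..<l}"
      using l_pos by (auto intro!: image_eqI[of _ _ "nat (t mod int l)"] simp: nat_less_iff)
  qed
qed (auto simp: track_def)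

lemma inj_on_track: "inj_on (\<lambda>t. config (\<lambda>i. c i - int t)) {..<l}"
  by (rule inj_onI) (auto simp: config_shift_eq_iff)

lemma card_track: "card (track c) = l"
  unfolding track_eq by (simp add: card_image inj_on_track)

lemma track_shift: "track (\<lambda>i. c i - s) = track c"
proof -
  have "config (\<lambda>i. c i - s - t) = config (\<lambda>i. c i - (s + t))" for t
    by (simp add: algebra_simps)
  moreover have "config (\<lambda>i. c i - t) = config (\<lambda>i. c i - s - (t - s))" for t by simp
  ultimately show ?thesis unfolding track_def by blast
qed

lemma track_cong: "config c = config d \<Longrightarrow> track c = track d"
proof -
  assume "config c = config d"
  then have "config (\<lambda>i. c i - t) = config (\<lambda>i. d i - t)" for t
    unfolding config_cong_iff by (metis mod_diff_left_eq)
  then show ?thesis unfolding track_def by simp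
qed

lemma track_eqI:
  assumes "config d \<in> track c"
  shows "track d = track c"
proof -
  obtain t where "config d = config (\<lambda>i. c i - t)" using assms unfolding track_def by blast
  then have "track d = track (\<lambda>i. c i - t)" by (rule track_cong)
  then show ?thesis by (simp only: track_shift)
qed

lemma config_in_track: "config c \<in> track c"
  unfolding track_def by (rule range_eqI[of _ _ 0]) simp

lemma Root_notin_track: "{Root} \<notin> track c"
  unfolding track_def using Root_notin_config by auto

lemma empty_in_track_const: "{} \<in> track (\<lambda>_. k)"
  unfolding track_def
  by (rule range_eqI[of _ _ k]) (simp add: config_empty_iff[THEN iffD2])

lemma orbit_track:
  assumes "{} \<notin> track c" "A \<in> track c"
  shows "orbit \<rho> A = track c"
proof -
  have "\<rho> (config (\<lambda>i. c i - int t)) = config (\<lambda>i. c i - int (Suc t mod l))" for t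
  proof -
    have "config (\<lambda>i. c i - int t) \<noteq> {}" using assms(1) unfolding track_def by (metis rangeI)
    then have "\<rho> (config (\<lambda>i. c i - int t)) = config (\<lambda>i. c i - int (Suc t))"
      by (simp add: rowmotion_config algebra_simps)
    also have "\<dots> = config (\<lambda>i. c i - int (Suc t mod l))"
      unfolding config_shift_eq_iff by (simp only: zmod_int mod_mod_trivial)
    finally show ?thesis .
  qed
  then show ?thesis
    using orbit_of_closed_walk[of l \<rho> "\<lambda>t. config (\<lambda>i. c i - int t)" A] assms(2)
    unfolding track_eq by blast
qed

text \<open>
  The exceptional orbit: the odometer cycle through the empty antichain, with the root inserted
  after it. Starting at the image of the root, the code reaches \<open>{}\<close> at time \<open>l - 1\<close> and the
  root at time \<open>l\<close>, after which the walk closes.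
\<close>

lemma orbit_through_Root:
  assumes "A \<in> insert {Root} (track (\<lambda>_. - 1))"
  shows "orbit \<rho> A = insert {Root} (track (\<lambda>_. - 1))"
proof -
  \<comment> \<open>The offset \<open>-1\<close> is the image of the root, so that the root comes last on the walk.\<close>
  define g where "g t = (if t = l then {Root} else config (\<lambda>_. - 1 - int t))" for t
  have img: "g ` {..<Suc l} = insert {Root} (track (\<lambda>_. - 1))"
    unfolding track_eq lessThan_Suc by (auto simp: g_def)
  have empty_iff: "config (\<lambda>_. - 1 - int t) = {} \<longleftrightarrow> l dvd Suc t" for t
  proof -
    have "config (\<lambda>_. - 1 - int t) = {} \<longleftrightarrow> (\<forall>i\<in>{1..n}. int (\<alpha> i) dvd - int (Suc t))"
      by (simp add: config_empty_iff dvd_eq_mod_eq_0)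
    also have "\<dots> \<longleftrightarrow> int l dvd int (Suc t)"
      unfolding l_dvd_iff[of "int (Suc t)"] by (simp only: dvd_minus_iff)
    finally show ?thesis by (simp only: int_dvd_int_iff)
  qed
  have "\<rho> (g t) = g (Suc t mod Suc l)" if "t < Suc l" for t
  proof -
    consider "t = l" | "Suc t = l" | "Suc t < l" using \<open>t < Suc l\<close> by linarith
    then show ?thesis
    proof cases
      case 1
      then show ?thesis using l_pos by (simp add: g_def rowmotion_Root)
    next
      case 2
      then have "config (\<lambda>_. - 1 - int t) = {}" using empty_iff by simp
      then show ?thesis using 2 by (simp add: g_def rowmotion_empty)
    next
      case 3
      then have "config (\<lambda>_. - 1 - int t) \<noteq> {}" using empty_iff by (auto dest: dvd_imp_le)
      then show ?thesis using 3 by (simp add: g_def rowmotion_config algebra_simps)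
    qed
  qed
  then show ?thesis using orbit_of_closed_walk[of "Suc l" \<rho> g A] assms unfolding img by blast
qed

text \<open>
  Every antichain lies on a closed walk of one of the two kinds above. A cycle containing
  \<open>{}\<close> is the exceptional one, because \<open>{}\<close> determines its cycle.
\<close>

lemma orbit_cases:
  assumes "A \<in> antichains S"
  obtains c where "A \<in> orbit \<rho> A" "orbit \<rho> A = track c \<union> (if {} \<in> track c then {{Root}} else {})"
    "\<forall>B\<in>orbit \<rho> A. orbit \<rho> B = orbit \<rho> A"
proof -
  let ?Z = "insert {Root} (track (\<lambda>_. - 1))"
  show thesis
  proof (cases "A \<in> ?Z")
    case True
    then have "orbit \<rho> A = ?Z" by (rule orbit_through_Root)
    then show thesis
      using that[of "\<lambda>_. - 1"] True orbit_through_Root empty_in_track_const by auto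
  next
    case False
    then obtain c where c: "A = config c" using assms antichains_star by auto
    have "{} \<notin> track c"
    proof
      assume "{} \<in> track c"
      moreover have "{} = config (\<lambda>_. 0)" by (simp add: config_empty_iff[THEN iffD2])
      ultimately have "track (\<lambda>_. 0) = track c" using track_eqI by metis
      moreover have "track (\<lambda>_. 0) = track (\<lambda>_. - 1)" using track_shift[of "\<lambda>_. 0" 1] by simp
      ultimately show False using False c config_in_track by blast
    qed
    then show thesis using that[of c] orbit_track[of c] config_in_track[of c] c by auto
  qed
qed

lemma orbit_shape:
  assumes "\<O> \<in> orbs"
  obtains c where "\<O> = track c \<union> (if {} \<in> track c then {{Root}} else {})"
proof -
  obtain A where A: "A \<in> antichains S" "\<O> = orbit \<rho> A" using assms unfolding orbits_on_def by blast
  obtain c where "A \<in> orbit \<rho> A"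
      and c: "orbit \<rho> A = track c \<union> (if {} \<in> track c then {{Root}} else {})"
      and "\<forall>B\<in>orbit \<rho> A. orbit \<rho> B = orbit \<rho> A"
    using orbit_cases[OF A(1)] .
  show thesis by (rule that[of c]) (simp only: A(2) c)
qed

lemma orbit_unique:
  assumes "\<O> \<in> orbs" "B \<in> \<O>"
  shows "\<O> = orbit \<rho> B"
proof -
  obtain A where A: "A \<in> antichains S" "\<O> = orbit \<rho> A" using assms unfolding orbits_on_def by blast
  obtain c where "A \<in> orbit \<rho> A"
      "orbit \<rho> A = track c \<union> (if {} \<in> track c then {{Root}} else {})"
    and "\<forall>B\<in>orbit \<rho> A. orbit \<rho> B = orbit \<rho> A"
    using orbit_cases[OF A(1)] .
  then show ?thesis using assms(2) by (simp only: A(2))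
qed

lemma self_in_orbit: "A \<in> antichains S \<Longrightarrow> A \<in> orbit \<rho> A"
  by (erule orbit_cases)

definition \<delta> :: "star_elt set set \<Rightarrow> nat" where
  "\<delta> \<O> = (if {Root} \<in> \<O> then 1 else 0)"

text \<open>
  A sum over an orbit becomes a sum over one period of the odometer, plus the contribution of
  the root if the orbit passes through it.
\<close>

lemma orbit_sum:
  assumes "\<O> \<in> orbs"
  obtains c where "\<forall>f :: star_elt set \<Rightarrow> real.
       sum f \<O> = (\<Sum>t<l. f (config (\<lambda>i. c i - int t))) + real (\<delta> \<O>) * f {Root}"
proof -
  obtain c where c: "\<O> = track c \<union> (if {} \<in> track c then {{Root}} else {})"
    using orbit_shape[OF assms] .
  have \<delta>: "\<delta> \<O> = (if {} \<in> track c then 1 else 0)"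
    unfolding \<delta>_def c using Root_notin_track by auto
  have fin: "finite (track c)" unfolding track_eq by simp
  have "sum f \<O> = (\<Sum>t<l. f (config (\<lambda>i. c i - int t))) + real (\<delta> \<O>) * f {Root}"
    for f :: "star_elt set \<Rightarrow> real"
  proof -
    have "sum f \<O> = sum f (track c) + real (\<delta> \<O>) * f {Root}"
      unfolding \<delta> unfolding c using fin Root_notin_track by simp
    also have "sum f (track c) = (\<Sum>t<l. f (config (\<lambda>i. c i - int t)))"
      unfolding track_eq by (simp add: sum.reindex inj_on_track)
    finally show ?thesis .
  qed
  then show thesis by (blast intro: that)
qed

lemma card_orbit:
  assumes "\<O> \<in> orbs"
  shows "card \<O> = l + \<delta> \<O>"
proof -
  obtain c where c: "\<forall>f :: star_elt set \<Rightarrow> real.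
       sum f \<O> = (\<Sum>t<l. f (config (\<lambda>i. c i - int t))) + real (\<delta> \<O>) * f {Root}"
    using orbit_sum[OF assms] .
  from c[rule_format, of "\<lambda>_. 1"] have "real (card \<O>) = real (l + \<delta> \<O>)" by simp
  then show ?thesis by (simp only: of_nat_eq_iff)
qed

lemma finite_orbs: "finite orbs"
  unfolding orbits_on_def using finite_antichains by simp

lemma Root_orbit: "orbit \<rho> {Root} \<in> orbs" "{Root} \<in> orbit \<rho> {Root}"
  unfolding orbits_on_def using Root_antichain self_in_orbit by auto

text \<open>
  There are \<open>1 + \<Prod> \<alpha> i\<close> antichains. They are partitioned into orbits of size \<open>l\<close>, apart from
  the one orbit through the root, whose additional element accounts for the summand \<open>1\<close>.
\<close>

lemma card_orbs: "l * card orbs = (\<Prod>i=1..n. \<alpha> i)"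
proof -
  have "\<Union> orbs = antichains S"
    using self_in_orbit orbit_rowmotion_antichains[of S] unfolding orbits_on_def by blast
  moreover have "card (\<Union> orbs) = (\<Sum>\<O>\<in>orbs. card \<O>)"
  proof (rule card_Union_disjoint)
    show "pairwise disjnt orbs"
      unfolding pairwise_def disjnt_def using orbit_unique by blast
    show "finite \<O>" if "\<O> \<in> orbs" for \<O>
      using finite_subset[OF orbit_subset_antichains[OF that] finite_antichains] .
  qed
  moreover have "(\<Sum>\<O>\<in>orbs. card \<O>) = l * card orbs + (\<Sum>\<O>\<in>orbs. \<delta> \<O>)"
    by (simp add: card_orbit sum.distrib)
  moreover have "(\<Sum>\<O>\<in>orbs. \<delta> \<O>) = (\<Sum>\<O>\<in>orbs. if \<O> = orbit \<rho> {Root} then 1 else 0)"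
  proof (rule sum.cong[OF refl])
    fix \<O> assume "\<O> \<in> orbs"
    then have "{Root} \<in> \<O> \<longleftrightarrow> \<O> = orbit \<rho> {Root}"
      using orbit_unique Root_orbit by blast
    then show "\<delta> \<O> = (if \<O> = orbit \<rho> {Root} then 1 else 0)" by (simp add: \<delta>_def)
  qed
  then have "(\<Sum>\<O>\<in>orbs. \<delta> \<O>) = 1" using Root_orbit(1) finite_orbs by simp
  ultimately show ?thesis using card_antichains by simp
qed


section \<open>The statistics on an orbit\<close>

text \<open>
  The period \<open>l\<close> consists of \<open>l / \<alpha> i\<close> full turns of the \<open>i\<close>-th wheel of the odometer.
\<close>

lemma equidistribution:
  fixes f :: "int \<Rightarrow> real"
  assumes "i \<in> {1..n}"
  shows "(\<Sum>t<l. f ((c i - int t) mod int (\<alpha> i))) = real l / real (\<alpha> i) * (\<Sum>r<\<alpha> i. f (int r))"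
proof -
  obtain k where k: "l = k * \<alpha> i" using \<alpha>_dvd_l[OF assms] by (metis dvd_div_mult_self)
  have "real l / real (\<alpha> i) = real k" using k \<alpha>_ge[OF assms] by simp
  then show ?thesis using sum_over_residues[of f "c i" "\<alpha> i" k] k by simp
qed

lemma sum_chi_at_Elt:
  assumes "\<O> \<in> orbs" "i \<in> {1..n}" "1 \<le> j" "j < \<alpha> i"
  shows "(\<Sum>A\<in>\<O>. chi_at (Elt i j) A) = real l / real (\<alpha> i)"
proof -
  obtain c where c: "\<forall>f :: star_elt set \<Rightarrow> real.
       sum f \<O> = (\<Sum>t<l. f (config (\<lambda>i. c i - int t))) + real (\<delta> \<O>) * f {Root}"
    using orbit_sum[OF assms(1)] .
  have "(\<Sum>A\<in>\<O>. chi_at (Elt i j) A)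
      = (\<Sum>t<l. (\<lambda>r. if r = int j then 1 else 0) ((c i - int t) mod int (\<alpha> i)))"
    unfolding c[rule_format] using assms(2,3) by (auto simp: chi_at_def Elt_in_config intro!: sum.cong)
  also have "\<dots> = real l / real (\<alpha> i) * (\<Sum>r<\<alpha> i. if int r = int j then 1 else 0)"
    by (rule equidistribution[OF assms(2)])
  also have "(\<Sum>r<\<alpha> i. if int r = int j then 1 else 0 :: real) = 1" using assms(4) by simp
  finally show ?thesis by simp
qed

lemma sum_chi_at_Root:
  assumes "\<O> \<in> orbs"
  shows "(\<Sum>A\<in>\<O>. chi_at Root A) = real (\<delta> \<O>)"
proof -
  obtain c where c: "\<forall>f :: star_elt set \<Rightarrow> real.
       sum f \<O> = (\<Sum>t<l. f (config (\<lambda>i. c i - int t))) + real (\<delta> \<O>) * f {Root}"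
    using orbit_sum[OF assms(1)] .
  show ?thesis unfolding c[rule_format] by (simp add: chi_at_def Root_notin_config)
qed

lemma sum_chi_at_down_Elt:
  assumes "\<O> \<in> orbs" "i \<in> {1..n}" "1 \<le> j" "j < \<alpha> i"
  shows "(\<Sum>A\<in>\<O>. chi_at (Elt i j) (down S A)) = real j * real l / real (\<alpha> i)"
proof -
  obtain c where c: "\<forall>f :: star_elt set \<Rightarrow> real.
       sum f \<O> = (\<Sum>t<l. f (config (\<lambda>i. c i - int t))) + real (\<delta> \<O>) * f {Root}"
    using orbit_sum[OF assms(1)] .
  have "(\<Sum>A\<in>\<O>. chi_at (Elt i j) (down S A))
      = (\<Sum>t<l. (\<lambda>r. if 1 \<le> r \<and> r \<le> int j then 1 else 0) ((c i - int t) mod int (\<alpha> i)))"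
    unfolding c[rule_format] using assms(2-4)
    by (auto simp: chi_at_def Elt_in_down_config Elt_in_star down_Root intro!: sum.cong)
  also have "\<dots> = real l / real (\<alpha> i) * (\<Sum>r<\<alpha> i. if 1 \<le> int r \<and> int r \<le> int j then 1 else 0)"
    by (rule equidistribution[OF assms(2)])
  also have "(\<Sum>r<\<alpha> i. if 1 \<le> int r \<and> int r \<le> int j then 1 else 0 :: real)
      = (\<Sum>r\<in>{1..j}. 1)"
    by (rule sum.mono_neutral_cong_right) (use assms(4) in auto)
  finally show ?thesis by simp
qed

text \<open>
  The root lies in every nonempty down-set, so only the empty antichain is missed. As \<open>{}\<close> and
  the singleton of the root always lie in the same orbit, this loss cancels the extra element in
  the orbit size \<open>l + \<delta>\<close>.
\<close>

lemma sum_chi_at_down_Root: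
  assumes "\<O> \<in> orbs"
  shows "(\<Sum>A\<in>\<O>. chi_at Root (down S A)) = real l"
proof -
  have sub: "\<O> \<subseteq> antichains S" by (rule orbit_subset_antichains[OF assms])
  have fin: "finite \<O>" by (rule finite_subset[OF sub finite_antichains])
  have iff: "{} \<in> \<O> \<longleftrightarrow> {Root} \<in> \<O>"
  proof -
    obtain c where "\<O> = track c \<union> (if {} \<in> track c then {{Root}} else {})"
      using orbit_shape[OF assms] .
    then show ?thesis using Root_notin_track[of c] by auto
  qed
  have "(\<Sum>A\<in>\<O>. chi_at Root (down S A)) = (\<Sum>A\<in>\<O>. 1 - (if A = {} then 1 else 0))"
    by (rule sum.cong) (auto simp: chi_at_def Root_in_down)
  also have "\<dots> = real (card \<O>) - (if {} \<in> \<O> then 1 else 0)"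
    using fin by (simp add: sum_subtractf)
  also have "\<dots> = real l" unfolding card_orbit[OF assms] \<delta>_def iff by simp
  finally show ?thesis .
qed

lemma sum_card_by_element:
  assumes "\<And>A. A \<in> \<O> \<Longrightarrow> F A \<subseteq> S"
  shows "(\<Sum>A\<in>\<O>. chi (F A)) = (\<Sum>x\<in>S. \<Sum>A\<in>\<O>. chi_at x (F A))"
proof -
  have "chi (F A) = (\<Sum>x\<in>S. chi_at x (F A))" if "A \<in> \<O>" for A
  proof -
    have "(\<Sum>x\<in>S. chi_at x (F A)) = (\<Sum>x\<in>F A. 1)"
      by (rule sum.mono_neutral_cong_right)
        (use assms[OF that] finite_star in \<open>auto simp: chi_at_def\<close>)
    then show ?thesis by (simp add: chi_def)
  qed
  then have "(\<Sum>A\<in>\<O>. chi (F A)) = (\<Sum>A\<in>\<O>. \<Sum>x\<in>S. chi_at x (F A))" by simp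
  also have "\<dots> = (\<Sum>x\<in>S. \<Sum>A\<in>\<O>. chi_at x (F A))" by (rule sum.swap)
  finally show ?thesis .
qed

lemma sum_chi:
  assumes "\<O> \<in> orbs"
  shows "(\<Sum>A\<in>\<O>. chi A)
       = real (\<delta> \<O>) + (\<Sum>i=1..n. real l / real (\<alpha> i) * (real (\<alpha> i) - 1))"
proof -
  have "(\<Sum>A\<in>\<O>. chi A) = (\<Sum>x\<in>S. \<Sum>A\<in>\<O>. chi_at x A)"
    by (rule sum_card_by_element) (use orbit_subset_antichains[OF assms] in \<open>auto simp: antichains_def\<close>)
  also have "\<dots> = real (\<delta> \<O>) + (\<Sum>i=1..n. \<Sum>j=1..\<alpha> i - 1. \<Sum>A\<in>\<O>. chi_at (Elt i j) A)"
    unfolding sum_star by (simp add: sum_chi_at_Root[OF assms])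
  also have "(\<Sum>i=1..n. \<Sum>j=1..\<alpha> i - 1. \<Sum>A\<in>\<O>. chi_at (Elt i j) A)
      = (\<Sum>i=1..n. real l / real (\<alpha> i) * (real (\<alpha> i) - 1))"
  proof (rule sum.cong[OF refl])
    fix i assume i: "i \<in> {1..n}"
    have "(\<Sum>j=1..\<alpha> i - 1. \<Sum>A\<in>\<O>. chi_at (Elt i j) A) = (\<Sum>j=1..\<alpha> i - 1. real l / real (\<alpha> i))"
      by (rule sum.cong[OF refl], rule sum_chi_at_Elt[OF assms i]) auto
    then show "(\<Sum>j=1..\<alpha> i - 1. \<Sum>A\<in>\<O>. chi_at (Elt i j) A) = real l / real (\<alpha> i) * (real (\<alpha> i) - 1)"
      using \<alpha>_ge[OF i] by (simp add: of_nat_diff)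
  qed
  finally show ?thesis .
qed

lemma sum_chi_down:
  assumes "\<O> \<in> orbs"
  shows "(\<Sum>A\<in>\<O>. chi (down S A))
       = real l + (\<Sum>i=1..n. real l / real (\<alpha> i) * real (\<alpha> i choose 2))"
proof -
  have "(\<Sum>A\<in>\<O>. chi (down S A)) = (\<Sum>x\<in>S. \<Sum>A\<in>\<O>. chi_at x (down S A))"
    by (rule sum_card_by_element) (auto simp: down_def)
  also have "\<dots> = real l + (\<Sum>i=1..n. \<Sum>j=1..\<alpha> i - 1. \<Sum>A\<in>\<O>. chi_at (Elt i j) (down S A))"
    unfolding sum_star by (simp add: sum_chi_at_down_Root[OF assms])
  also have "(\<Sum>i=1..n. \<Sum>j=1..\<alpha> i - 1. \<Sum>A\<in>\<O>. chi_at (Elt i j) (down S A))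
      = (\<Sum>i=1..n. real l / real (\<alpha> i) * real (\<alpha> i choose 2))"
  proof (rule sum.cong[OF refl])
    fix i assume i: "i \<in> {1..n}"
    obtain a where a: "\<alpha> i = Suc a" using \<alpha>_ge[OF i] by (cases "\<alpha> i") auto
    have "(\<Sum>j=1..\<alpha> i - 1. \<Sum>A\<in>\<O>. chi_at (Elt i j) (down S A))
        = (\<Sum>j=1..a. real l / real (\<alpha> i) * real j)"
    proof (rule sum.cong)
      fix j assume "j \<in> {1..a}"
      then show "(\<Sum>A\<in>\<O>. chi_at (Elt i j) (down S A)) = real l / real (\<alpha> i) * real j"
        using sum_chi_at_down_Elt[OF assms i, of j] a by simp
    qed (simp add: a)
    also have "\<dots> = real l / real (\<alpha> i) * real (\<Sum>j=1..a. j)"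
      by (simp add: sum_distrib_left)
    also have "(\<Sum>j=1..a. j) = \<alpha> i choose 2"
      using gauss_sum_from_Suc_0[where 'a = nat, of a] a by (simp add: choose_two mult.commute)
    finally show "(\<Sum>j=1..\<alpha> i - 1. \<Sum>A\<in>\<O>. chi_at (Elt i j) (down S A))
      = real l / real (\<alpha> i) * real (\<alpha> i choose 2)" .
  qed
  finally show ?thesis .
qed


section \<open>Homometry and failure of homomesy\<close>

text \<open>
  The size \<open>l + \<delta>\<close> of an orbit determines \<open>\<delta>\<close>, and thereby every sum that depends on the orbit
  only through \<open>\<delta>\<close>.
\<close>

lemma homometricI:
  assumes "\<And>\<O>. \<O> \<in> orbs \<Longrightarrow> sum st \<O> = K + a * real (\<delta> \<O>)"
  shows "homometric \<rho> (antichains S) st"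
  unfolding homometric_def using assms card_orbit by simp

text \<open>
  The orbit through the root and any other orbit have averages \<open>(K + a) / (l + 1)\<close> and
  \<open>K / l\<close>, which coincide only for \<open>K = a l\<close>.
\<close>

lemma not_homomesicI:
  assumes sum: "\<And>\<O>. \<O> \<in> orbs \<Longrightarrow> sum st \<O> = K + a * real (\<delta> \<O>)"
    and two: "card orbs \<ge> 2" and K: "K \<noteq> a * real l"
  shows "\<not> homomesic \<rho> (antichains S) st"
proof
  assume "homomesic \<rho> (antichains S) st"
  then obtain m where m: "\<And>\<O>. \<O> \<in> orbs \<Longrightarrow> sum st \<O> / real (card \<O>) = m"
    unfolding homomesic_def by blast
  have "orbs \<noteq> {orbit \<rho> {Root}}" using two by auto
  then obtain \<O> where \<O>: "\<O> \<in> orbs" "\<O> \<noteq> orbit \<rho> {Root}" using Root_orbit(1) by blast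
  have "\<delta> \<O> = 0" using \<O> orbit_unique unfolding \<delta>_def by auto
  then have "K / real l = m" using m[OF \<O>(1)] sum[OF \<O>(1)] card_orbit[OF \<O>(1)] by simp
  moreover have "(K + a) / (real l + 1) = m"
    using m[OF Root_orbit(1)] sum[OF Root_orbit(1)] card_orbit[OF Root_orbit(1)] Root_orbit(2)
    by (simp add: \<delta>_def add.commute)
  ultimately have "K / real l = (K + a) / (real l + 1)" by simp
  then have "K = a * real l" using l_pos by (simp add: field_simps)
  with K show False by blast
qed

text \<open>
  After division by \<open>l\<close> this says that the numbers \<open>1 - 1/\<alpha> i\<close> do not add up to \<open>1\<close>. There are
  at least two of them and each is at least \<open>1/2\<close>, so the sum is \<open>1\<close> only in the excluded case.
\<close>

lemma antichain_total_ne_l: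
  assumes "\<not> (n = 2 \<and> \<alpha> 1 = 2 \<and> \<alpha> 2 = 2)"
  shows "(\<Sum>i=1..n. real l / real (\<alpha> i) * (real (\<alpha> i) - 1)) \<noteq> real l"
proof -
  define w where "w i = (real (\<alpha> i) - 1) / real (\<alpha> i)" for i
  have half: "w i \<ge> 1/2" if "i \<in> {1..n}" for i
    using \<alpha>_ge[OF that] unfolding w_def by (simp add: field_simps)
  have "(\<Sum>i=1..n. w i) \<noteq> 1"
  proof
    assume one: "(\<Sum>i=1..n. w i) = 1"
    have "(\<Sum>i=1..n. 1/2) \<le> (\<Sum>i=1..n. w i)" by (rule sum_mono) (rule half)
    with one n_ge have n: "n = 2" by simp
    then have "w 1 + w 2 = 1" using one by (simp add: numeral_2_eq_2)
    with half[of 1] half[of 2] n have "w 1 = 1/2" "w 2 = 1/2" by auto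
    then have "\<alpha> 1 = 2" "\<alpha> 2 = 2"
      using \<alpha>_ge[of 1] \<alpha>_ge[of 2] n unfolding w_def by (simp_all add: field_simps)
    with n assms show False by blast
  qed
  moreover have "(\<Sum>i=1..n. real l / real (\<alpha> i) * (real (\<alpha> i) - 1)) = real l * (\<Sum>i=1..n. w i)"
    unfolding w_def by (simp add: sum_distrib_left)
  ultimately show ?thesis using l_pos by simp
qed

end

theorem theorem3p1:
  fixes n l \<delta> :: nat and \<alpha> :: "nat \<Rightarrow> nat"
    and S :: "star_elt set" and \<O> :: "star_elt set set"
  assumes "n \<ge> 2"
    and "\<forall>i\<in>{1..n}. \<alpha> i \<ge> 2"
    and "S = star n \<alpha>"
    and "\<O> \<in> orbits_on (rowmotion S) (antichains S)"
    and "l = Lcm (\<alpha> ` {1..n})"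
    and "\<delta> = (if {Root} \<in> \<O> then 1 else 0)"
  shows
    \<comment> \<open>(a)\<close>
    "(card \<O> = l + \<delta> \<and>
      real (card (orbits_on (rowmotion S) (antichains S)))
        = real (\<Prod>i=1..n. \<alpha> i) / real l) \<and>
     \<comment> \<open>(b)\<close>
     ((\<forall>i\<in>{1..n}. \<forall>x\<in>branch \<alpha> i. (\<Sum>A\<in>\<O>. chi_at x A) = real l / real (\<alpha> i)) \<and>
      (\<Sum>A\<in>\<O>. chi_at Root A) = real \<delta>) \<and>
     \<comment> \<open>(c)\<close>
     ((\<Sum>A\<in>\<O>. chi A) = real \<delta> + (\<Sum>i=1..n. real l / real (\<alpha> i) * (real (\<alpha> i) - 1)) \<and>
      homometric (rowmotion S) (antichains S) chi \<and>
      (card (orbits_on (rowmotion S) (antichains S)) \<ge> 2 \<and>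
       \<not> (n = 2 \<and> \<alpha> 1 = 2 \<and> \<alpha> 2 = 2) \<longrightarrow>
         \<not> homomesic (rowmotion S) (antichains S) chi)) \<and>
     \<comment> \<open>(d)\<close>
     ((\<forall>i\<in>{1..n}. \<forall>j\<in>{1..\<alpha> i - 1}.
         (\<Sum>A\<in>\<O>. chi_at (Elt i j) (down S A)) = real j * real l / real (\<alpha> i)) \<and>
      (\<Sum>A\<in>\<O>. chi_at Root (down S A)) = real l) \<and>
     \<comment> \<open>(e)\<close>
     ((\<Sum>A\<in>\<O>. chi (down S A)) = real l + (\<Sum>i=1..n. real l / real (\<alpha> i) * real (\<alpha> i choose 2)) \<and>
      homometric (ideal_rowmotion S) (ideals S) chi \<and>
      (card (orbits_on (rowmotion S) (antichains S)) \<ge> 2 \<longrightarrow>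
         \<not> homomesic (ideal_rowmotion S) (ideals S) chi))"
proof -
  interpret st: star_shape n \<alpha> using assms(1,2) by unfold_locales auto
  have S: "S = star n \<alpha>" by fact
  have l: "st.l = l" using assms(5) by (simp add: st.l_def)
  have \<delta>: "st.\<delta> \<O> = \<delta>" using assms(6) by (simp add: st.\<delta>_def)
  have \<O>: "\<O> \<in> st.orbs" using assms(4) S by simp
  have lpos: "l > 0" using st.l_pos l by simp
  let ?K = "\<Sum>i=1..n. real l / real (\<alpha> i) * (real (\<alpha> i) - 1)"
  let ?M = "real l + (\<Sum>i=1..n. real l / real (\<alpha> i) * real (\<alpha> i choose 2))"
  have chi: "sum chi \<O>' = ?K + 1 * real (st.\<delta> \<O>')" if "\<O>' \<in> st.orbs" for \<O>'
    using st.sum_chi[OF that] l by simp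
  have chi_down: "(\<Sum>A\<in>\<O>'. chi (down (star n \<alpha>) A)) = ?M + 0 * real (st.\<delta> \<O>')"
    if "\<O>' \<in> st.orbs" for \<O>'
    using st.sum_chi_down[OF that] l by simp
  have "?M > 0"
    using lpos by (intro add_pos_nonneg sum_nonneg) auto
  then have M: "?M \<noteq> 0 * real st.l" by simp

  have a: "card \<O> = l + \<delta>" "real (card st.orbs) = real (\<Prod>i=1..n. \<alpha> i) / real l"
    using st.card_orbit[OF \<O>] st.card_orbs lpos unfolding l \<delta>
    by (simp_all add: field_simps flip: of_nat_mult of_nat_prod)
  have b: "\<forall>i\<in>{1..n}. \<forall>x\<in>branch \<alpha> i. (\<Sum>A\<in>\<O>. chi_at x A) = real l / real (\<alpha> i)"
    using st.sum_chi_at_Elt[OF \<O>] st.\<alpha>_ge unfolding l branch_def by fastforce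
  have d: "\<forall>i\<in>{1..n}. \<forall>j\<in>{1..\<alpha> i - 1}.
      (\<Sum>A\<in>\<O>. chi_at (Elt i j) (down (star n \<alpha>) A)) = real j * real l / real (\<alpha> i)"
    using st.sum_chi_at_down_Elt[OF \<O>] st.\<alpha>_ge unfolding l by fastforce
  have c: "homometric st.\<rho> (antichains (star n \<alpha>)) chi"
    by (rule st.homometricI) (rule chi)
  have c': "\<not> homomesic st.\<rho> (antichains (star n \<alpha>)) chi"
    if "card st.orbs \<ge> 2 \<and> \<not> (n = 2 \<and> \<alpha> 1 = 2 \<and> \<alpha> 2 = 2)"
    using st.not_homomesicI[OF chi] st.antichain_total_ne_l that unfolding l by simp
  have e: "homometric (ideal_rowmotion (star n \<alpha>)) (ideals (star n \<alpha>)) chi"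
    unfolding ideal_homometric_iff[OF st.finite_star]
    by (rule st.homometricI) (rule chi_down)
  have e': "\<not> homomesic (ideal_rowmotion (star n \<alpha>)) (ideals (star n \<alpha>)) chi"
    if "card st.orbs \<ge> 2"
    unfolding ideal_homomesic_iff[OF st.finite_star]
    by (rule st.not_homomesicI[OF chi_down that M])
  show ?thesis
    unfolding S
    using a b c c' d e e' st.sum_chi_at_Root[OF \<O>] st.sum_chi_at_down_Root[OF \<O>]
      chi[OF \<O>] chi_down[OF \<O>] unfolding l \<delta> by simp
qed

end
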